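(* Let $d\ge1$, let $\mathbb{F}$ be a field with $|\mathbb{F}|>d$, and let $S\subseteq\mathbb{F}$ with $|S|>d$. Let $f\in\mathbb{F}_{\bar{A},C}[x_1,\ldots,x_n]$ be a non-zero polynomial of degree $\le d$, given as a black box with query access to evaluations of $f$ on elements of $\mathbb{C}_d$. Sample $b_1,\ldots,b_n\in\mathbb{C}_d$ by picking each of the $d(d+1)^2+1$ coordinates of each $b_i$ uniformly and independently from $S$. Then $$\Pr_{b_1,\ldots,b_n\in\mathbb{C}_d}[f(b_1,\ldots,b_n)=0]\le d/|S|.$$
   Context: $\mathbb{F}_{\bar{A},C}[X]$ ($X=\{x_1,\ldots,x_n\}$) is the commutative, nonassociative polynomial algebra: the $\mathbb{F}$-vector space with basis the commutative nonassociative monomials, namely the degree-$0$ monomial $1$ and, in degree $\ge1$, rooted full binary trees whose leaves are labeled by variables, identified up to swapping the two children at internal nodes; the product of monomials $m_1,m_2$ is the tree whose root has subtrees $m_1,m_2$, extended bilinearly. Degree of a monomial = number of leaves; degree of $f$ = max degree of a monomial with non-zero coefficient. Let $\mathbb{A}'_d=\mathbb{F}^{d(d+1)^2}$ with elements indexed $x[i,j,k]$, $1\le i,j\le d+1$, $1\le k\le d$, and product $z=x\circ y$ with $z[i,j,d]=0$, $z[i,j,k]=\sum_{l=1}^{d+1}x[i,l,k+1]y[l,j,k+1]$ for $1\le k\le d-1$. Let $\mathbb{A}_d=\{(a,\alpha):a\in\mathbb{A}'_d,\alpha\in\mathbb{F}\}\cong\mathbb{F}^{d(d+1)^2+1}$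 with product $(a_1,\alpha_1)\cdot(a_2,\alpha_2)=(a_1\circ a_2+\alpha_1a_2+\alpha_2a_1,\alpha_1\alpha_2)$, and let $\mathbb{C}_d$ be the same vector space with product $a\odot b=a\cdot b+b\cdot a$. Evaluation: $f(b_1,\ldots,b_n)=\sum_m c_m m(b)$ for $f=\sum_m c_m m$, where $1\mapsto(\mathbf0,1)$, $x_i\mapsto b_i$, and a monomial with root subtrees $m_1,m_2$ maps to $m_1(b)\odot m_2(b)$.
   Formalization: The formal theorem additionally assumes that the field has characteristic different from 2 unless d = 1; in characteristic 2 with d ≥ 2 the claim fails, since x₁x₁ is non-zero but vanishes at every point of C_d. *)

theory Defs
  imports
    "HOL-Probability.Probability"
    "HOL-Library.Uprod"
    "HOL-Library.Poly_Mapping"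
    "HOL-Library.Function_Algebras"
    "HOL-Computational_Algebra.Computational_Algebra"
begin

section \<open>Commutative nonassociative polynomials\<close>

text \<open>
  The unordered pair of children at an internal node realises the identification of trees
  up to swapping the two children.
\<close>

datatype (vars_tree: 'v) ctree = Leaf 'v | Node "'v ctree uprod"

lift_definition plus_commute :: "(nat, nat) commute" is "(+)"
  by (simp add: add.commute)

primrec leaves :: "'v ctree \<Rightarrow> nat" where
  "leaves (Leaf v) = 1"
| "leaves (Node p) = case_uprod plus_commute (map_uprod leaves p)"

datatype (vars_monom: 'v) cna_monom = One | Tree "'v ctree"

primrec monom_degree :: "'v cna_monom \<Rightarrow> nat" where
  "monom_degree One = 0"
| "monom_degree (Tree t) = leaves t"

text \<open>The vector space with basis the monomials: finitely supported coefficient functions.\<close>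

type_synonym ('v, 'a) cna_poly = "'v cna_monom \<Rightarrow>\<^sub>0 'a"

definition cna_vars :: "('v, 'a::zero) cna_poly \<Rightarrow> 'v set" where
  "cna_vars f = (\<Union>m\<in>Poly_Mapping.keys f. vars_monom m)"

text \<open>The zero polynomial gets degree 0.\<close>

definition cna_degree :: "('v, 'a::zero) cna_poly \<Rightarrow> nat" where
  "cna_degree f = Max (insert 0 (monom_degree ` Poly_Mapping.keys f))"


section \<open>The algebras\<close>

definition A'_index :: "nat \<Rightarrow> (nat \<times> nat \<times> nat) set" where
  "A'_index d = {1..d+1} \<times> {1..d+1} \<times> {1..d}"

text \<open>
  As the dimension depends on \<open>d\<close>, a coordinate vector is a function on all index triples
  that vanishes outside \<open>A'_index d\<close>.
\<close>

type_synonym 'a A'_vec = "nat \<times> nat \<times> nat \<Rightarrow> 'a"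
type_synonym 'a A_vec = "'a A'_vec \<times> 'a"

definition A'_mult :: "nat \<Rightarrow> 'a::field A'_vec \<Rightarrow> 'a A'_vec \<Rightarrow> 'a A'_vec" where
  "A'_mult d x y = (\<lambda>(i, j, k).
     if (i, j, k) \<in> A'_index d \<and> k < d
     then \<Sum>l=1..d+1. x (i, l, k + 1) * y (l, j, k + 1) else 0)"

definition A'_scale :: "'a::field \<Rightarrow> 'a A'_vec \<Rightarrow> 'a A'_vec" where
  "A'_scale c x = (\<lambda>q. c * x q)"

definition A_scale :: "'a::field \<Rightarrow> 'a A_vec \<Rightarrow> 'a A_vec" where
  "A_scale c = (\<lambda>(a, \<alpha>). (A'_scale c a, c * \<alpha>))"

definition A_mult :: "nat \<Rightarrow> 'a::field A_vec \<Rightarrow> 'a A_vec \<Rightarrow> 'a A_vec" where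
  "A_mult d = (\<lambda>(a1, \<alpha>1) (a2, \<alpha>2).
     (A'_mult d a1 a2 + A'_scale \<alpha>1 a2 + A'_scale \<alpha>2 a1, \<alpha>1 * \<alpha>2))"

definition C_mult :: "nat \<Rightarrow> 'a::field A_vec \<Rightarrow> 'a A_vec \<Rightarrow> 'a A_vec" where
  "C_mult d a b = A_mult d a b + A_mult d b a"


section \<open>Evaluation\<close>

lift_definition C_mult_commute :: "nat \<Rightarrow> ('a::field A_vec, 'a A_vec) commute" is C_mult
  by (simp add: C_mult_def add.commute)

primrec eval_tree :: "nat \<Rightarrow> ('v \<Rightarrow> 'a::field A_vec) \<Rightarrow> 'v ctree \<Rightarrow> 'a A_vec" where
  "eval_tree d b (Leaf v) = b v"
| "eval_tree d b (Node p) = case_uprod (C_mult_commute d) (map_uprod (eval_tree d b) p)"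

lemma leaves_Node_Upair: "leaves (Node (Upair s t)) = leaves s + leaves t"
  by (simp add: plus_commute.rep_eq)

lemma eval_tree_Node_Upair:
  "eval_tree d b (Node (Upair s t)) = C_mult d (eval_tree d b s) (eval_tree d b t)"
  by (simp add: C_mult_commute.rep_eq)

text \<open>
  The monomial \<open>1\<close> goes to \<open>(0, 1)\<close>, which is neutral for \<^const>\<open>A_mult\<close>
  but not for \<^const>\<open>C_mult\<close>.
\<close>

primrec eval_monom :: "nat \<Rightarrow> ('v \<Rightarrow> 'a::field A_vec) \<Rightarrow> 'v cna_monom \<Rightarrow> 'a A_vec" where
  "eval_monom d b One = (0, 1)"
| "eval_monom d b (Tree t) = eval_tree d b t"

definition cna_eval :: "nat \<Rightarrow> ('v \<Rightarrow> 'a::field A_vec) \<Rightarrow> ('v, 'a) cna_poly \<Rightarrow> 'a A_vec" where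
  "cna_eval d b f =
     (\<Sum>m\<in>Poly_Mapping.keys f. A_scale (Poly_Mapping.lookup f m) (eval_monom d b m))"

text \<open>
  In characteristic 2 every square in the commutative algebra is zero, so the nonzero quadratic
  polynomial \<open>x x\<close> vanishes at every point, whatever \<open>d\<close> is.
\<close>

lemma cna_eval_square_char_2:
  fixes b :: "'v \<Rightarrow> 'a::field A_vec"
  assumes "CHAR('a) = 2"
  shows "cna_eval d b (Poly_Mapping.single (Tree (Node (Upair (Leaf v) (Leaf v)))) 1) = 0"
proof -
  have two: "(2::'a) = 0"
    using of_nat_CHAR[where 'a = 'a] assms by simp
  have "C_mult d a a = 0" for a :: "'a A_vec"
    by (simp add: C_mult_def prod_eq_iff fun_eq_iff two flip: mult_2)
  then show ?thesis
    by (simp add: cna_eval_def A_scale_def A'_scale_def eval_tree_Node_Upair zero_prod_def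
        zero_fun_def del: eval_tree.simps)
qed


section \<open>Sampling\<close>

text \<open>Coordinates outside \<open>A'_index d\<close>, and points outside \<open>{1..n}\<close>, default to 0.\<close>

definition random_C :: "nat \<Rightarrow> 'a::field set \<Rightarrow> 'a A_vec pmf" where
  "random_C d S = pair_pmf (Pi_pmf (A'_index d) 0 (\<lambda>_. pmf_of_set S)) (pmf_of_set S)"

definition random_points :: "nat \<Rightarrow> nat \<Rightarrow> 'a::field set \<Rightarrow> (nat \<Rightarrow> 'a A_vec) pmf" where
  "random_points n d S = Pi_pmf {1..n} 0 (\<lambda>_. random_C d S)"

end

(*
  Every coordinate of f(b) is a polynomial function of degree at most d in the coordinates of b, so
  by Schwartz-Zippel it suffices that one coordinate is non-zero at a single point over the field.
  Draw a tree t of f in the plane and let (v, k) be the label and layer (depth + 1) of its p-th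
  leaf; set x_v[p, p+1, k] = 1 for all p and everything else to 0. The layers of the leaves, read
  from left to right, determine the plane tree, so at this point the coordinate [1, leaves t + 1, 1]
  vanishes on every monomial other than t. On t it counts the drawings that coincide with the
  chosen one, which is a power of 2: each node with two equal children doubles the count. This is
  where characteristic 2 is excluded; for d = 1 the tree is a leaf and the power is 1.
*)

theory Submission
  imports Defs
begin

section \<open>Polynomial functions\<close>

text \<open>Functions rather than formal polynomials: evaluation in the algebra then gets its degree
  bound by induction on the tree, without computing coefficients. \<open>k\<close> is only an upper
  bound for the degree.\<close>

inductive polynomial_fun :: "'w set \<Rightarrow> nat \<Rightarrow> (('w \<Rightarrow> 'a::comm_ring_1) \<Rightarrow> 'a) \<Rightarrow> bool"
  for V where
  const: "polynomial_fun V k (\<lambda>_. c)"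
| var: "w \<in> V \<Longrightarrow> polynomial_fun V 1 (\<lambda>x. x w)"
| add: "polynomial_fun V k F \<Longrightarrow> polynomial_fun V k G \<Longrightarrow> polynomial_fun V k (\<lambda>x. F x + G x)"
| mult: "polynomial_fun V k F \<Longrightarrow> polynomial_fun V l G \<Longrightarrow> polynomial_fun V (k + l) (\<lambda>x. F x * G x)"

lemma polynomial_fun_mono:
  assumes "polynomial_fun V k F" and "k \<le> l"
  shows "polynomial_fun V l F"
  using polynomial_fun.mult[OF assms(1) polynomial_fun.const[of V "l - k" 1]] assms(2) by simp

lemma polynomial_fun_sum:
  assumes "\<And>i. i \<in> I \<Longrightarrow> polynomial_fun V k (F i)"
  shows "polynomial_fun V k (\<lambda>x. \<Sum>i\<in>I. F i x)"
  using assms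
  by (induction I rule: infinite_finite_induct)
    (auto intro: polynomial_fun.const polynomial_fun.add)

lemma polynomial_fun_cong:
  assumes "polynomial_fun V k F" and "\<And>w. w \<in> V \<Longrightarrow> x w = y w"
  shows "F x = F y"
  using assms by induction auto

text \<open>The coefficients \<open>G i\<close> no longer involve \<open>v\<close>, and the degree
  \<open>k\<close> splits into \<open>i\<close> and \<open>k - i\<close>. Padding by zero beyond
  \<open>k\<close> lets products of expansions be Cauchy products over the full index range.\<close>

lemma polynomial_fun_insert_expand:
  fixes F :: "('w \<Rightarrow> 'a::idom) \<Rightarrow> 'a"
  assumes "polynomial_fun (insert v V) k F"
  obtains G where "\<And>i. i \<le> k \<Longrightarrow> polynomial_fun V (k - i) (G i)"
    and "\<And>i x. i > k \<Longrightarrow> G i x = 0"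
    and "\<And>x. F x = (\<Sum>i\<le>k. G i x * x v ^ i)"
proof -
  have "\<exists>G. (\<forall>i\<le>k. polynomial_fun V (k - i) (G i)) \<and> (\<forall>i x. i > k \<longrightarrow> G i x = 0) \<and>
            (\<forall>x. F x = (\<Sum>i\<le>k. G i x * x v ^ i))"
    using assms
  proof induction
    case (const k c)
    show ?case
      by (rule exI[of _ "\<lambda>i _. if i = 0 then c else 0"])
        (auto simp: if_distrib[of "\<lambda>c. c * _"] intro: polynomial_fun.const cong: if_cong)
  next
    case (var w)
    show ?case
    proof (cases "w = v")
      case True
      then show ?thesis
        by (intro exI[of _ "\<lambda>i _. if i = 1 then 1 else 0"]) (auto intro: polynomial_fun.const)
    next
      case False
      with var have "polynomial_fun V 1 (\<lambda>x. x w)"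
        by (auto intro: polynomial_fun.var[simplified])
      then show ?thesis
        by (intro exI[of _ "\<lambda>i x. if i = 0 then x w else 0"])
          (auto intro: polynomial_fun.const simp: le_Suc_eq)
    qed
  next
    case (add k F G)
    from add.IH obtain A B where
      A: "\<forall>i\<le>k. polynomial_fun V (k - i) (A i)" "\<forall>i x. i > k \<longrightarrow> A i x = 0"
         "\<forall>x. F x = (\<Sum>i\<le>k. A i x * x v ^ i)" and
      B: "\<forall>i\<le>k. polynomial_fun V (k - i) (B i)" "\<forall>i x. i > k \<longrightarrow> B i x = 0"
         "\<forall>x. G x = (\<Sum>i\<le>k. B i x * x v ^ i)"
      by blast
    then show ?case
      by (intro exI[of _ "\<lambda>i x. A i x + B i x"])
        (auto intro: polynomial_fun.add simp: sum.distrib distrib_right)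
  next
    case (mult k F l G)
    from mult.IH obtain A B where
      A: "\<forall>i\<le>k. polynomial_fun V (k - i) (A i)" "\<forall>i x. i > k \<longrightarrow> A i x = 0"
         "\<forall>x. F x = (\<Sum>i\<le>k. A i x * x v ^ i)" and
      B: "\<forall>i\<le>l. polynomial_fun V (l - i) (B i)" "\<forall>i x. i > l \<longrightarrow> B i x = 0"
         "\<forall>x. G x = (\<Sum>i\<le>l. B i x * x v ^ i)"
      by blast
    define C where "C r = (\<lambda>x. \<Sum>j\<le>r. A j x * B (r - j) x)" for r
    have summand: "polynomial_fun V (k + l - r) (\<lambda>x. A j x * B (r - j) x)"
      if "j \<le> r" "r \<le> k + l" for j r
    \<comment> \<open>Natural subtraction is exact for indices in range; out of range a padded
      coefficient makes the summand zero.\<close>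
    proof (cases "j \<le> k \<and> r - j \<le> l")
      case True
      then have "polynomial_fun V ((k - j) + (l - (r - j))) (\<lambda>x. A j x * B (r - j) x)"
        using A(1) B(1) by (intro polynomial_fun.mult) simp_all
      moreover have "(k - j) + (l - (r - j)) = k + l - r"
        using True that by auto
      ultimately show ?thesis by simp
    next
      case False
      then have "(\<lambda>x. A j x * B (r - j) x) = (\<lambda>_. 0)"
        using A(2) B(2) by (metis (no_types) linorder_not_le mult_zero_left mult_zero_right)
      then show ?thesis by (simp add: polynomial_fun.const)
    qed
    have "polynomial_fun V (k + l - r) (C r)" if "r \<le> k + l" for r
      unfolding C_def
    proof (rule polynomial_fun_sum)
      fix j assume "j \<in> {..r}"
      with that show "polynomial_fun V (k + l - r) (\<lambda>x. A j x * B (r - j) x)"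
        by (intro summand) simp_all
    qed
    moreover have "C r x = 0" if "r > k + l" for r x
      unfolding C_def
    proof (rule sum.neutral, rule ballI)
      fix j assume "j \<in> {..r}"
      with that have "j > k \<or> r - j > l" by auto
      then show "A j x * B (r - j) x = 0"
      proof
        assume "j > k"
        with A(2) show ?thesis by simp
      next
        assume "r - j > l"
        with B(2) show ?thesis by simp
      qed
    qed
    moreover have "F x * G x = (\<Sum>r\<le>k + l. C r x * x v ^ r)" for x
      unfolding C_def using A(2,3) B(2,3) polynomial_product[of k "\<lambda>i. A i x" l "\<lambda>i. B i x" "x v"]
      by simp
    ultimately show ?case by blast
  qed
  then show ?thesis using that by blast
qed

section \<open>Roots in one variable and Schwartz-Zippel on a grid\<close>

lemma card_power_sum_roots_le:
  fixes c :: "nat \<Rightarrow> 'a::idom"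
  assumes "c i \<noteq> 0"
  shows "finite {y. (\<Sum>j\<le>i. c j * y ^ j) = 0}" and "card {y. (\<Sum>j\<le>i. c j * y ^ j) = 0} \<le> i"
proof -
  define p where "p = (\<Sum>j\<le>i. monom (c j) j)"
  have p: "poly p y = (\<Sum>j\<le>i. c j * y ^ j)" for y
    by (simp add: p_def poly_sum poly_monom)
  have "coeff p i = c i"
    by (simp add: p_def coeff_sum)
  with assms have "p \<noteq> 0" by auto
  moreover have "degree p \<le> i"
    unfolding p_def by (intro degree_sum_le) (auto intro: order_trans[OF degree_monom_le])
  ultimately show "finite {y. (\<Sum>j\<le>i. c j * y ^ j) = 0}"
    and "card {y. (\<Sum>j\<le>i. c j * y ^ j) = 0} \<le> i"
    using poly_roots_finite[of p] card_poly_roots_bound[of p] by (simp_all add: p)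
qed

lemma PiE_dflt_insert_image:
  assumes "v \<notin> V"
  shows "PiE_dflt (insert v V) z B = (\<lambda>(g, y). g(v := y)) ` (PiE_dflt V z B \<times> B v)"
proof (intro equalityI subsetI)
  fix x assume x: "x \<in> PiE_dflt (insert v V) z B"
  \<comment> \<open>An element of the smaller grid takes the default value outside \<open>V\<close>,
    so \<open>v\<close> is reset to \<open>z\<close>.\<close>
  then have "(x(v := z), x v) \<in> PiE_dflt V z B \<times> B v"
    using assms by (auto simp: PiE_dflt_def)
  then show "x \<in> (\<lambda>(g, y). g(v := y)) ` (PiE_dflt V z B \<times> B v)"
    by (rule rev_image_eqI) auto
next
  fix x assume "x \<in> (\<lambda>(g, y). g(v := y)) ` (PiE_dflt V z B \<times> B v)"
  then show "x \<in> PiE_dflt (insert v V) z B"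
    by (fastforce simp: PiE_dflt_def)
qed

text \<open>
  Non-vanishing is only required at some point of the whole space, not on the grid; this is how
  ``nonzero polynomial'' enters without speaking of coefficients.
\<close>

theorem schwartz_zippel:
  fixes F :: "('w \<Rightarrow> 'a::idom) \<Rightarrow> 'a"
  assumes "finite V" and "finite S"
    and "polynomial_fun V k F" and "F x0 \<noteq> 0"
  shows "card {x \<in> PiE_dflt V z (\<lambda>_. S). F x = 0} * card S \<le> k * card S ^ card V"
  using assms(1,3,4)
proof (induction V arbitrary: F k x0 rule: finite_induct)
  case empty
  have "F x = F x0" for x
    using polynomial_fun_cong[OF empty(1)] by blast
  with empty(2) have "F x \<noteq> 0" for x by metis
  then show ?case by simp
next
  case (insert v V)
  obtain G where G: "\<And>i. i \<le> k \<Longrightarrow> polynomial_fun V (k - i) (G i)"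
    "\<And>i x. i > k \<Longrightarrow> G i x = 0" "\<And>x. F x = (\<Sum>i\<le>k. G i x * x v ^ i)"
    using polynomial_fun_insert_expand[OF insert.prems(1)] by blast
  \<comment> \<open>\<open>i\<close> is the largest power of \<open>x v\<close> whose coefficient is
    not identically zero; the induction hypothesis will be applied to that coefficient.\<close>
  define I where "I = {i. i \<le> k \<and> (\<exists>x. G i x \<noteq> 0)}"
  define i where "i = Max I"
  have "finite I"
    unfolding I_def by simp
  moreover have "I \<noteq> {}"
  proof
    assume "I = {}"
    then have "G j x0 = 0" if "j \<le> k" for j
      using that by (auto simp: I_def)
    then have "F x0 = 0"
      unfolding G(3) by (intro sum.neutral) simp
    with insert.prems(2) show False by contradiction
  qed
  ultimately have "i \<in> I" and i_max: "\<And>j. j \<in> I \<Longrightarrow> j \<le> i"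
    unfolding i_def by simp_all
  then obtain x1 where i: "i \<le> k" "G i x1 \<noteq> 0"
    by (auto simp: I_def)
  have high: "G j x = 0" if "j > i" for j x
    using that i_max[of j] G(2)[of j x] by (auto simp: I_def not_less[symmetric])
  have F: "F (g(v := y)) = (\<Sum>j\<le>i. G j g * y ^ j)" for g y
  proof -
    have "G j (g(v := y)) = G j g" if "j \<le> k" for j
      using insert.hyps(2) by (intro polynomial_fun_cong[OF G(1)[OF that]]) auto
    then have "F (g(v := y)) = (\<Sum>j\<le>k. G j g * y ^ j)"
      unfolding G(3) by (intro sum.cong) auto
    also have "\<dots> = (\<Sum>j\<le>i. G j g * y ^ j)"
      using i(1) high by (intro sum.mono_neutral_right) auto
    finally show ?thesis .
  qed
  define P where "P = PiE_dflt V z (\<lambda>_. S)"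
  define Z where "Z = {g \<in> P. G i g = 0}"
  have "finite P"
    unfolding P_def using insert.hyps assms(2) by (intro finite_PiE_dflt) auto
  have card_P: "card P = card S ^ card V"
    unfolding P_def using insert.hyps assms(2) by (subst card_PiE_dflt) auto
  \<comment> \<open>Where the leading coefficient vanishes, the whole line over \<open>g\<close> may
    consist of zeros; elsewhere a polynomial of degree \<open>i\<close> has at most \<open>i\<close>
    roots.\<close>
  have fibre: "card {y \<in> S. F (g(v := y)) = 0} \<le> (if g \<in> Z then card S else 0) + i"
    if "g \<in> P" for g
  proof (cases "g \<in> Z")
    case True
    then show ?thesis using assms(2) by (auto intro: card_mono trans_le_add1)
  next
    case False
    with that have "G i g \<noteq> 0" by (simp add: Z_def)
    note roots = card_power_sum_roots_le[where c = "\<lambda>j. G j g", OF this]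
    have "card {y \<in> S. F (g(v := y)) = 0} \<le> card {y. (\<Sum>j\<le>i. G j g * y ^ j) = 0}"
      using roots(1) by (intro card_mono) (auto simp: F)
    with roots(2) False show ?thesis by simp
  qed
  have "{x \<in> PiE_dflt (insert v V) z (\<lambda>_. S). F x = 0}
      \<subseteq> (\<lambda>(g, y). g(v := y)) ` (SIGMA g:P. {y \<in> S. F (g(v := y)) = 0})"
    unfolding PiE_dflt_insert_image[OF insert.hyps(2)] P_def by force
  then have "card {x \<in> PiE_dflt (insert v V) z (\<lambda>_. S). F x = 0}
      \<le> card (SIGMA g:P. {y \<in> S. F (g(v := y)) = 0})"
    using \<open>finite P\<close> assms(2) by (intro surj_card_le) auto
  also have "\<dots> = (\<Sum>g\<in>P. card {y \<in> S. F (g(v := y)) = 0})"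
    using \<open>finite P\<close> assms(2) by (intro card_SigmaI) auto
  also have "\<dots> \<le> (\<Sum>g\<in>P. (if g \<in> Z then card S else 0) + i)"
    by (intro sum_mono fibre)
  also have "\<dots> = card Z * card S + card P * i"
  proof -
    have "P \<inter> Z = Z" by (auto simp: Z_def)
    then show ?thesis using \<open>finite P\<close> by (simp add: sum.distrib sum.If_cases)
  qed
  \<comment> \<open>The degree is shared out: \<open>k - i\<close> pays for the bad points
    \<open>Z\<close> through the induction hypothesis, and \<open>i\<close> for the roots on the
    lines.\<close>
  also have "\<dots> \<le> (k - i) * card S ^ card V + card P * i"
    using insert.IH[OF G(1)[OF i(1)] i(2)] unfolding Z_def P_def by simp
  also have "\<dots> = k * card S ^ card V"
    using i(1) by (simp add: card_P mult.commute[of _ i] flip: distrib_right)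
  finally show ?case
    using insert.hyps by (simp add: mult.assoc mult.commute[of "card S"])
qed

section \<open>Detecting a tree by a single point\<close>

lemma ctree_Upair_induct [case_names Leaf Node]:
  assumes "\<And>v. P (Leaf v)" and "\<And>s t. P s \<Longrightarrow> P t \<Longrightarrow> P (Node (Upair s t))"
  shows "P t"
proof (induction t)
  case (Leaf v)
  show ?case by (rule assms(1))
next
  case (Node p)
  then show ?case by (cases p) (auto intro: assms(2))
qed

lemma leaves_pos: "leaves t > 0"
  by (induction t rule: ctree_Upair_induct) (simp_all add: leaves_Node_Upair del: leaves.simps(2))

text \<open>
  \<open>lays_out \<sigma> t k i j\<close>: some plane drawing of \<open>t\<close> with root at depth \<open>k\<close> has its leaves, from left
  to right, at the positions \<open>i, \<dots>, j - 1\<close>, and \<open>\<sigma>\<close> lists their labels and depths.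
\<close>

inductive lays_out :: "(nat \<Rightarrow> 'v \<times> nat) \<Rightarrow> 'v ctree \<Rightarrow> nat \<Rightarrow> nat \<Rightarrow> nat \<Rightarrow> bool"
  for \<sigma> where
  Leaf: "\<sigma> i = (v, k) \<Longrightarrow> lays_out \<sigma> (Leaf v) k i (Suc i)"
| Node: "lays_out \<sigma> s (Suc k) i l \<Longrightarrow> lays_out \<sigma> t (Suc k) l j \<Longrightarrow>
    lays_out \<sigma> (Node (Upair s t)) k i j"

lemma lays_out_leaves:
  assumes "lays_out \<sigma> t k i j"
  shows "j = i + leaves t"
  using assms by induction (simp_all add: leaves_Node_Upair del: leaves.simps(2))

text \<open>Depth grows on the way down. Hence the depth of the first leaf tells whether a drawing
  at depth \<open>k\<close> is a single leaf or has an inner node as its root.\<close>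

lemma lays_out_first_depth:
  assumes "lays_out \<sigma> t k i j"
  shows "k \<le> snd (\<sigma> i)"
  using assms by induction auto

text \<open>A layout can be parsed from the left: the first leaf decides between leaf and node, the
  left child ends at a determined position, and the right child starts there. This is what separates
  the monomials of \<open>f\<close>.\<close>

lemma lays_out_unique:
  assumes "lays_out \<sigma> t k i j" and "lays_out \<sigma> t' k i j'"
  shows "t = t' \<and> j = j'"
  using assms
proof (induction arbitrary: t' j')
  case (Leaf i v k)
  from Leaf.prems show ?case
  proof cases
    case (Leaf w)
    with Leaf.hyps show ?thesis by simp
  next
    case (Node s l t)
    with lays_out_first_depth[OF Node(2)] Leaf.hyps show ?thesis by simp
  qed
next
  case (Node s k i l t j)
  from Node.prems show ?case
  proof cases
    case (Leaf w)
    with lays_out_first_depth[OF Node.hyps(1)] show ?thesis by simp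
  next
    case (Node s' l' t')
    with Node.IH(1)[OF Node(2)] Node.IH(2)[of t' j'] show ?thesis by auto
  qed
qed

lemma lays_out_exists: "\<exists>\<sigma>. lays_out \<sigma> t k i (i + leaves t)"
proof -
  \<comment> \<open>The list is required to work between arbitrary \<open>xs\<close> and
    \<open>ys\<close>, so that the lists of two children can be concatenated.\<close>
  have "\<exists>c. length c = leaves t \<and>
      (\<forall>xs ys. lays_out (\<lambda>p. (xs @ c @ ys) ! p) t k (length xs) (length xs + leaves t))"
  proof (induction t arbitrary: k rule: ctree_Upair_induct)
    case (Leaf v)
    show ?case
      by (rule exI[of _ "[(v, k)]"]) (auto intro: lays_out.Leaf)
  next
    case (Node s t)
    from Node.IH[of "Suc k"] obtain a b where
      a: "length a = leaves s"
        "\<And>xs ys. lays_out (\<lambda>p. (xs @ a @ ys) ! p) s (Suc k) (length xs) (length xs + leaves s)" and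
      b: "length b = leaves t"
        "\<And>xs ys. lays_out (\<lambda>p. (xs @ b @ ys) ! p) t (Suc k) (length xs) (length xs + leaves t)"
      by blast
    show ?case
    proof (intro exI[of _ "a @ b"] conjI allI)
      fix xs ys
      show "lays_out (\<lambda>p. (xs @ (a @ b) @ ys) ! p) (Node (Upair s t)) k (length xs)
          (length xs + leaves (Node (Upair s t)))"
        using a(2)[of xs "b @ ys"] b(2)[of "xs @ a" ys]
        by (intro lays_out.Node[of _ _ _ _ "length xs + leaves s"])
          (simp_all add: a(1) leaves_Node_Upair add.assoc del: leaves.simps(2))
    qed (simp add: a b leaves_Node_Upair del: leaves.simps(2))
  qed
  then obtain c where c: "\<And>xs ys. lays_out (\<lambda>p. (xs @ c @ ys) ! p) t k (length xs) (length xs + leaves t)"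
    by blast
  show ?thesis
    using c[of "replicate i undefined" "[]"] by auto
qed

text \<open>Layers stand for depths, because the factors of \<open>A'_mult\<close> are read one
  layer deeper than the product; the entry in row \<open>p\<close> and column \<open>p + 1\<close>
  consumes leaf \<open>p\<close>. Entries outside \<open>A'_index d\<close> are not cut off:
  \<open>schwartz_zippel\<close> accepts a non-vanishing point anywhere.\<close>

definition layout_point :: "(nat \<Rightarrow> 'v \<times> nat) \<Rightarrow> 'v \<Rightarrow> 'a::field A_vec" where
  "layout_point \<sigma> v = (\<lambda>(i, j, k). if j = Suc i \<and> \<sigma> i = (v, k) then 1 else 0, 0)"

section \<open>Evaluation at a layout point\<close>

lemma fst_C_mult:
  "fst (C_mult d x y) = A'_mult d (fst x) (fst y) + A'_mult d (fst y) (fst x) +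
     A'_scale (2 * snd x) (fst y) + A'_scale (2 * snd y) (fst x)"
  by (cases x; cases y) (simp add: C_mult_def A_mult_def A'_scale_def fun_eq_iff algebra_simps)

lemma snd_C_mult: "snd (C_mult d x y) = 2 * snd x * snd y"
  by (cases x; cases y) (simp add: C_mult_def A_mult_def)

text \<open>Vanishing scalar parts remove the cross terms of \<open>C_mult\<close>; the two matrix
  products remain.\<close>

lemma snd_eval_layout_point: "snd (eval_tree d (layout_point \<sigma>) t) = 0"
  by (induction t rule: ctree_Upair_induct)
    (simp_all add: layout_point_def eval_tree_Node_Upair snd_C_mult del: eval_tree.simps(2))

lemma fst_eval_layout_Node:
  "fst (eval_tree d (layout_point \<sigma>) (Node (Upair s t))) =
     A'_mult d (fst (eval_tree d (layout_point \<sigma>) s)) (fst (eval_tree d (layout_point \<sigma>) t)) +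
     A'_mult d (fst (eval_tree d (layout_point \<sigma>) t)) (fst (eval_tree d (layout_point \<sigma>) s))"
  by (simp add: eval_tree_Node_Upair fst_C_mult snd_eval_layout_point A'_scale_def fun_eq_iff
      del: eval_tree.simps(2))

lemma A'_mult_nonzeroE:
  assumes "A'_mult d x y (i, j, k) \<noteq> 0"
  obtains l where "x (i, l, Suc k) \<noteq> 0" and "y (l, j, Suc k) \<noteq> 0"
proof -
  from assms have "(\<Sum>l=1..d+1. x (i, l, k + 1) * y (l, j, k + 1)) \<noteq> 0"
    by (auto simp: A'_mult_def split: if_splits)
  then obtain l where "x (i, l, k + 1) * y (l, j, k + 1) \<noteq> 0"
    by (meson sum.neutral)
  then show ?thesis by (intro that) auto
qed

text \<open>A non-zero matrix product has a non-zero summand, whose middle index is where the leaves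
  of one child end and those of the other begin. As \<open>Upair\<close> is unordered, both orders
  draw the same node.\<close>

lemma lays_out_of_eval_nonzero:
  fixes \<sigma> :: "nat \<Rightarrow> 'v \<times> nat"
  assumes "fst (eval_tree d (layout_point \<sigma> :: 'v \<Rightarrow> 'a::field A_vec) t) (i, j, k) \<noteq> 0"
  shows "lays_out \<sigma> t k i j"
  using assms
proof (induction t arbitrary: i j k rule: ctree_Upair_induct)
  case (Leaf v)
  then show ?case
    by (auto simp: layout_point_def intro: lays_out.Leaf split: if_splits)
next
  case (Node s t)
  let ?e = "\<lambda>t. fst (eval_tree d (layout_point \<sigma> :: 'v \<Rightarrow> 'a A_vec) t)"
  have "A'_mult d (?e s) (?e t) (i, j, k) \<noteq> 0 \<or> A'_mult d (?e t) (?e s) (i, j, k) \<noteq> 0"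
    using Node.prems unfolding fst_eval_layout_Node by auto
  then show ?case
  proof
    assume "A'_mult d (?e s) (?e t) (i, j, k) \<noteq> 0"
    then show ?thesis
      by (rule A'_mult_nonzeroE) (auto intro: lays_out.Node Node.IH)
  next
    assume "A'_mult d (?e t) (?e s) (i, j, k) \<noteq> 0"
    then have "lays_out \<sigma> (Node (Upair t s)) k i j"
      by (rule A'_mult_nonzeroE) (auto intro: lays_out.Node Node.IH)
    moreover have "Upair t s = Upair s t" by simp
    ultimately show ?thesis by simp
  qed
qed

text \<open>
  The two children of a node can both be laid out in either order only if they are equal, so every
  node contributes a factor 1 or 2.
\<close>

lemma eval_layout_point_power_of_2:
  fixes d :: nat and \<sigma> :: "nat \<Rightarrow> 'v \<times> nat"
  assumes "lays_out \<sigma> t k i j" and "1 \<le> k" and "1 \<le> i" and "j \<le> d + 1" and "k + leaves t \<le> d + 1"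
  shows "\<exists>m < leaves t. fst (eval_tree d (layout_point \<sigma> :: 'v \<Rightarrow> 'a::field A_vec) t) (i, j, k) = 2 ^ m"
  using assms
proof induction
  case (Leaf i v k)
  then show ?case by (simp add: layout_point_def)
next
  case (Node s k i l t j)
  let ?e = "\<lambda>t. fst (eval_tree d (layout_point \<sigma> :: 'v \<Rightarrow> 'a A_vec) t)"
  have len: "leaves (Node (Upair s t)) = leaves s + leaves t"
    by (rule leaves_Node_Upair)
  note pos = leaves_pos[of s] leaves_pos[of t]
  have l: "l = i + leaves s" "j = l + leaves t"
    using lays_out_leaves Node.hyps by blast+
  \<comment> \<open>Each child lies one layer deeper; the leaves of its sibling, at least one, make
    room for this in the bound \<open>d + 1\<close>.\<close>
  have "\<exists>m < leaves s. ?e s (i, l, Suc k) = 2 ^ m"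
    using Node.prems len l pos by (intro Node.IH(1)) auto
  then obtain a where a: "a < leaves s" "?e s (i, l, Suc k) = 2 ^ a" by blast
  have "\<exists>m < leaves t. ?e t (l, j, Suc k) = 2 ^ m"
    using Node.prems len l pos by (intro Node.IH(2)) auto
  then obtain b where b: "b < leaves t" "?e t (l, j, Suc k) = 2 ^ b" by blast
  have range: "(i, j, k) \<in> A'_index d \<and> k < d"
    using Node.prems len l pos by (auto simp: A'_index_def)
  have *: "A'_mult d (?e s) (?e t) (i, j, k) = 2 ^ (a + b)"
  proof -
    have "A'_mult d (?e s) (?e t) (i, j, k) =
        (\<Sum>l'=1..d+1. ?e s (i, l', Suc k) * ?e t (l', j, Suc k))"
      using range by (simp add: A'_mult_def)
    \<comment> \<open>A non-zero entry of \<open>s\<close> at \<open>(i, l', Suc k)\<close> comes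
      from a drawing of \<open>s\<close> starting at \<open>i\<close>, and
      \<open>lays_out_unique\<close> fixes its right end as \<open>l\<close>.\<close>
    also have "\<dots> = (\<Sum>l'\<in>{l}. ?e s (i, l', Suc k) * ?e t (l', j, Suc k))"
    proof (rule sum.mono_neutral_right)
      show "\<forall>l'\<in>{1..d+1} - {l}. ?e s (i, l', Suc k) * ?e t (l', j, Suc k) = 0"
        using lays_out_of_eval_nonzero lays_out_unique[OF Node.hyps(1)] by fastforce
    qed (use Node.prems l pos in auto)
    finally show ?thesis by (simp add: a b power_add)
  qed
  show ?case
  proof (cases "s = t")
    case True
    have "?e (Node (Upair s t)) (i, j, k) = 2 ^ Suc (a + b)"
      unfolding fst_eval_layout_Node using * True by simp
    moreover have "Suc (a + b) < leaves (Node (Upair s t))"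
      using a b len by simp
    ultimately show ?thesis by blast
  next
    case False
    have "A'_mult d (?e t) (?e s) (i, j, k) = 0"
    proof (rule ccontr)
      assume "A'_mult d (?e t) (?e s) (i, j, k) \<noteq> 0"
      then obtain l' where "?e t (i, l', Suc k) \<noteq> 0"
        by (rule A'_mult_nonzeroE)
      then show False
        using lays_out_of_eval_nonzero lays_out_unique[OF Node.hyps(1)] False by blast
    qed
    then have "?e (Node (Upair s t)) (i, j, k) = 2 ^ (a + b)"
      unfolding fst_eval_layout_Node using * by simp
    moreover have "a + b < leaves (Node (Upair s t))"
      using a b len by simp
    ultimately show ?thesis by blast
  qed
qed

lemma sum_fun_apply: "(\<Sum>i\<in>I. F i) x = (\<Sum>i\<in>I. F i x)"
  by (induction I rule: infinite_finite_induct) auto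

lemma fst_cna_eval:
  "fst (cna_eval d b f) q =
     (\<Sum>m\<in>Poly_Mapping.keys f. Poly_Mapping.lookup f m * fst (eval_monom d b m) q)"
  by (simp add: cna_eval_def fst_sum sum_fun_apply A_scale_def A'_scale_def case_prod_unfold)

lemma snd_cna_eval:
  "snd (cna_eval d b f) =
     (\<Sum>m\<in>Poly_Mapping.keys f. Poly_Mapping.lookup f m * snd (eval_monom d b m))"
  by (simp add: cna_eval_def snd_sum A_scale_def case_prod_unfold)

lemma cna_eval_nonzero_coordinate:
  fixes f :: "('v, 'a::field) cna_poly"
  assumes t: "Tree t \<in> Poly_Mapping.keys f" and "leaves t \<le> d"
    and "d = 1 \<or> (2::'a) \<noteq> 0"
  obtains b where "fst (cna_eval d b f) (1, 1 + leaves t, 1) \<noteq> 0"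
proof -
  let ?q = "(1, 1 + leaves t, 1) :: nat \<times> nat \<times> nat"
  obtain \<sigma> where \<sigma>: "lays_out \<sigma> t 1 1 (1 + leaves t)"
    using lays_out_exists by blast
  let ?b = "layout_point \<sigma> :: 'v \<Rightarrow> 'a A_vec"
  obtain m where m: "m < leaves t" "fst (eval_tree d ?b t) ?q = 2 ^ m"
    using eval_layout_point_power_of_2[OF \<sigma>, of d] assms(2) by auto
  \<comment> \<open>\<open>One\<close> has zero matrix part, and another tree with a non-zero entry
    here would share the layout of \<open>t\<close>.\<close>
  have other: "fst (eval_monom d ?b m') ?q = 0" if "m' \<noteq> Tree t" for m'
  proof (cases m')
    case One
    then show ?thesis by simp
  next
    case (Tree t')
    then show ?thesis
      using that lays_out_of_eval_nonzero lays_out_unique[OF \<sigma>] by fastforce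
  qed
  have "fst (cna_eval d ?b f) ?q =
      (\<Sum>m'\<in>{Tree t}. Poly_Mapping.lookup f m' * fst (eval_monom d ?b m') ?q)"
    unfolding fst_cna_eval using t other by (intro sum.mono_neutral_right) auto
  also have "\<dots> = Poly_Mapping.lookup f (Tree t) * 2 ^ m"
    using m(2) by simp
  \<comment> \<open>For \<open>d = 1\<close> the tree has one leaf, so \<open>m < leaves t\<close>
    forces \<open>m = 0\<close> and the power is 1 in every characteristic.\<close>
  also have "\<dots> \<noteq> 0"
    using assms m(1) t by (auto simp: in_keys_iff)
  finally show ?thesis by (rule that)
qed

section \<open>Coordinates of evaluations as polynomial functions\<close>

text \<open>\<open>None\<close> indexes the scalar coordinate.\<close>

definition coords :: "nat \<Rightarrow> nat \<Rightarrow> (nat \<times> (nat \<times> nat \<times> nat) option) set" where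
  "coords n d = {1..n} \<times> insert None (Some ` A'_index d)"

text \<open>Regroups a flat assignment of field elements, the form that
  \<open>schwartz_zippel\<close> takes, into one algebra element per variable.\<close>

definition points_of :: "('v \<times> (nat \<times> nat \<times> nat) option \<Rightarrow> 'a) \<Rightarrow> 'v \<Rightarrow> 'a A_vec" where
  "points_of x v = (\<lambda>q. x (v, Some q), x (v, None))"

definition coords_of :: "('v \<Rightarrow> 'a A_vec) \<Rightarrow> 'v \<times> (nat \<times> nat \<times> nat) option \<Rightarrow> 'a" where
  "coords_of b = (\<lambda>(v, p). case p of None \<Rightarrow> snd (b v) | Some q \<Rightarrow> fst (b v) q)"

lemma points_of_coords_of [simp]: "points_of (coords_of b) = b"
  by (simp add: points_of_def coords_of_def fun_eq_iff)

lemma coords_of_points_of [simp]: "coords_of (points_of x) = x"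
  by (auto simp: points_of_def coords_of_def fun_eq_iff split: option.split)

lemma finite_A'_index: "finite (A'_index d)"
  by (simp add: A'_index_def)

lemma finite_coords: "finite (coords n d)"
  by (simp add: coords_def finite_A'_index)

lemma polynomial_fun_cmult:
  assumes "polynomial_fun V k F"
  shows "polynomial_fun V k (\<lambda>x. c * F x)"
  using polynomial_fun.mult[OF polynomial_fun.const[of V 0 c] assms] by simp

lemma polynomial_fun_A'_mult:
  assumes "\<And>q. q \<in> A'_index d \<Longrightarrow> polynomial_fun V k (\<lambda>x. X x q)"
    and "\<And>q. q \<in> A'_index d \<Longrightarrow> polynomial_fun V l (\<lambda>x. Y x q)"
  shows "polynomial_fun V (k + l) (\<lambda>x. A'_mult d (X x) (Y x) q)"
proof -
  obtain i j h where q: "q = (i, j, h)" by (metis surj_pair)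
  show ?thesis
  proof (cases "(i, j, h) \<in> A'_index d \<and> h < d")
    case True
    \<comment> \<open>\<open>h < d\<close> keeps layer \<open>h + 1\<close>, from which both factors
      are read, inside the index set.\<close>
    then have "polynomial_fun V (k + l) (\<lambda>x. \<Sum>p=1..d+1. X x (i, p, h + 1) * Y x (p, j, h + 1))"
      by (intro polynomial_fun_sum polynomial_fun.mult assms) (auto simp: A'_index_def)
    with True show ?thesis by (simp add: q A'_mult_def)
  next
    case False
    then have "(\<lambda>x. A'_mult d (X x) (Y x) q) = (\<lambda>_. 0)"
      by (auto simp: q A'_mult_def)
    then show ?thesis by (simp add: polynomial_fun.const)
  qed
qed

text \<open>Scalar and matrix parts share one induction because \<open>C_mult\<close> mixes them;
  degrees add at each node. Matrix coordinates are limited to \<open>A'_index d\<close>, as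
  \<open>coords\<close> contains no others.\<close>

lemma polynomial_fun_eval_tree:
  fixes t :: "nat ctree"
  assumes "vars_tree t \<subseteq> {1..n}"
  shows "polynomial_fun (coords n d) (leaves t)
      (\<lambda>x. snd (eval_tree d (points_of x :: nat \<Rightarrow> 'a::field A_vec) t)) \<and>
    (\<forall>q \<in> A'_index d. polynomial_fun (coords n d) (leaves t)
      (\<lambda>x. fst (eval_tree d (points_of x :: nat \<Rightarrow> 'a::field A_vec) t) q))"
  using assms
proof (induction t rule: ctree_Upair_induct)
  case (Leaf v)
  then show ?case
    by (auto simp: points_of_def coords_def intro!: polynomial_fun.var[simplified])
next
  case (Node s t)
  let ?V = "coords n d"
  let ?e = "\<lambda>t x. eval_tree d (points_of x :: nat \<Rightarrow> 'a A_vec) t"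
  have s: "polynomial_fun ?V (leaves s) (\<lambda>x. snd (?e s x))"
    "\<And>q. q \<in> A'_index d \<Longrightarrow> polynomial_fun ?V (leaves s) (\<lambda>x. fst (?e s x) q)"
    and t: "polynomial_fun ?V (leaves t) (\<lambda>x. snd (?e t x))"
    "\<And>q. q \<in> A'_index d \<Longrightarrow> polynomial_fun ?V (leaves t) (\<lambda>x. fst (?e t x) q)"
    using Node by auto
  have "polynomial_fun ?V (leaves s + leaves t) (\<lambda>x. 2 * (snd (?e s x) * snd (?e t x)))"
    by (intro polynomial_fun_cmult polynomial_fun.mult s t)
  moreover have "polynomial_fun ?V (leaves s + leaves t) (\<lambda>x.
      A'_mult d (fst (?e s x)) (fst (?e t x)) q + A'_mult d (fst (?e t x)) (fst (?e s x)) q +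
      2 * (snd (?e s x) * fst (?e t x) q) + 2 * (snd (?e t x) * fst (?e s x) q))"
    if "q \<in> A'_index d" for q
  proof (intro polynomial_fun.add polynomial_fun_cmult)
    show "polynomial_fun ?V (leaves s + leaves t) (\<lambda>x. A'_mult d (fst (?e s x)) (fst (?e t x)) q)"
      by (intro polynomial_fun_A'_mult s t)
    show "polynomial_fun ?V (leaves s + leaves t) (\<lambda>x. A'_mult d (fst (?e t x)) (fst (?e s x)) q)"
      unfolding add.commute[of "leaves s"] by (intro polynomial_fun_A'_mult s t)
    show "polynomial_fun ?V (leaves s + leaves t) (\<lambda>x. snd (?e s x) * fst (?e t x) q)"
      by (intro polynomial_fun.mult s t that)
    show "polynomial_fun ?V (leaves s + leaves t) (\<lambda>x. snd (?e t x) * fst (?e s x) q)"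
      unfolding add.commute[of "leaves s"] by (intro polynomial_fun.mult s t that)
  qed
  ultimately show ?case
    by (simp add: leaves_Node_Upair eval_tree_Node_Upair fst_C_mult snd_C_mult A'_scale_def
        mult.assoc del: leaves.simps(2) eval_tree.simps(2))
qed

lemma monom_degree_le_cna_degree:
  assumes "m \<in> Poly_Mapping.keys f"
  shows "monom_degree m \<le> cna_degree f"
  using assms by (auto simp: cna_degree_def)

lemma polynomial_fun_cna_eval:
  fixes f :: "(nat, 'a::field) cna_poly"
  assumes "cna_vars f \<subseteq> {1..n}" and "cna_degree f \<le> k" and "q \<in> A'_index d"
  shows "polynomial_fun (coords n d) k (\<lambda>x. fst (cna_eval d (points_of x) f) q)"
  unfolding fst_cna_eval
proof (intro polynomial_fun_sum polynomial_fun_cmult)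
  fix m assume m: "m \<in> Poly_Mapping.keys f"
  show "polynomial_fun (coords n d) k (\<lambda>x. fst (eval_monom d (points_of x :: nat \<Rightarrow> 'a A_vec) m) q)"
  proof (cases m)
    case One
    then show ?thesis by (simp add: polynomial_fun.const)
  next
    case (Tree t)
    then have "vars_tree t \<subseteq> cna_vars f" "leaves t \<le> k"
      using m assms(2) monom_degree_le_cna_degree[OF m] by (force simp: cna_vars_def)+
    with assms(1) have "vars_tree t \<subseteq> {1..n}" "leaves t \<le> k" by blast+
    then have "polynomial_fun (coords n d) k
        (\<lambda>x. fst (eval_tree d (points_of x :: nat \<Rightarrow> 'a A_vec) t) q)"
      using polynomial_fun_eval_tree[of t n d] assms(3) by (blast intro: polynomial_fun_mono)
    with Tree show ?thesis by simp
  qed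
qed

section \<open>Sampling\<close>

lemma random_C_eq_pmf_of_set:
  assumes "finite S" and "S \<noteq> {}"
  shows "random_C d S = pmf_of_set (PiE_dflt (A'_index d) 0 (\<lambda>_. S) \<times> S)"
proof -
  have fin: "finite (PiE_dflt (A'_index d) (0::'a) (\<lambda>_. S))"
    using assms finite_A'_index by (intro finite_PiE_dflt) auto
  have ne: "PiE_dflt (A'_index d) (0::'a) (\<lambda>_. S) \<noteq> {}"
    using assms by simp
  show ?thesis
  proof (rule pmf_eqI)
    fix c :: "'a A_vec"
    show "pmf (random_C d S) c = pmf (pmf_of_set (PiE_dflt (A'_index d) 0 (\<lambda>_. S) \<times> S)) c"
      using assms fin ne
      by (cases c) (simp add: random_C_def pmf_pair Pi_pmf_of_set finite_A'_index
          card_cartesian_product indicator_times)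
  qed
qed

text \<open>Independent uniform coordinates amount to one uniform draw from the grid over all
  coordinates, which turns the probability into a count. Both sides default to zero, so regrouping
  is a bijection.\<close>

lemma random_points_eq_map_pmf:
  assumes "finite S" and "S \<noteq> {}"
  shows "random_points n d S = map_pmf points_of (pmf_of_set (PiE_dflt (coords n d) 0 (\<lambda>_. S)))"
proof -
  let ?B = "PiE_dflt {1..n} 0 (\<lambda>_. PiE_dflt (A'_index d) 0 (\<lambda>_. S) \<times> S)"
  have "bij_betw points_of (PiE_dflt (coords n d) 0 (\<lambda>_. S)) ?B"
  proof (rule bij_betw_byWitness[where f' = coords_of])
    show "points_of ` PiE_dflt (coords n d) 0 (\<lambda>_. S) \<subseteq> ?B"
    proof (rule image_subsetI)
      fix x :: "nat \<times> (nat \<times> nat \<times> nat) option \<Rightarrow> 'a"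
      assume "x \<in> PiE_dflt (coords n d) 0 (\<lambda>_. S)"
      then have x: "(v, p) \<in> coords n d \<Longrightarrow> x (v, p) \<in> S"
        "(v, p) \<notin> coords n d \<Longrightarrow> x (v, p) = 0" for v p
        unfolding PiE_dflt_def by blast+
      have "x (v, None) \<in> S" "q \<in> A'_index d \<Longrightarrow> x (v, Some q) \<in> S" if "v \<in> {1..n}" for v q
        using x(1) that by (auto simp: coords_def)
      moreover have "x (v, Some q) = 0" if "q \<notin> A'_index d" for v q
        by (rule x(2)) (use that in \<open>auto simp: coords_def\<close>)
      moreover have "x (v, p) = 0" if "v \<notin> {1..n}" for v p
        by (rule x(2)) (use that in \<open>auto simp: coords_def\<close>)
      ultimately show "points_of x \<in> ?B"
        unfolding PiE_dflt_def points_of_def by (simp add: zero_prod_def zero_fun_def)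
    qed
    show "coords_of ` ?B \<subseteq> PiE_dflt (coords n d) 0 (\<lambda>_. S)"
    proof clarify
      fix b assume "b \<in> ?B"
      then have "\<And>i. i \<in> {1..n} \<Longrightarrow> snd (b i) \<in> S" "\<And>i q. i \<in> {1..n} \<Longrightarrow> q \<in> A'_index d \<Longrightarrow> fst (b i) q \<in> S"
        and b: "\<And>i q. i \<in> {1..n} \<Longrightarrow> q \<notin> A'_index d \<Longrightarrow> fst (b i) q = 0" "\<And>i. i \<notin> {1..n} \<Longrightarrow> b i = 0"
        unfolding PiE_dflt_def by (auto simp: mem_Times_iff)
      moreover have "fst (b i) q = 0" if "q \<notin> A'_index d" for i q
        using that b by (cases "i \<in> {1..n}") simp_all
      ultimately show "coords_of b \<in> PiE_dflt (coords n d) 0 (\<lambda>_. S)"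
        unfolding PiE_dflt_def coords_of_def coords_def
        by (auto split: option.split simp: inj_image_mem_iff)
    qed
  qed auto
  moreover have "finite (PiE_dflt (coords n d) 0 (\<lambda>_. S))"
    using assms finite_coords by (intro finite_PiE_dflt) auto
  ultimately have "map_pmf points_of (pmf_of_set (PiE_dflt (coords n d) 0 (\<lambda>_. S))) = pmf_of_set ?B"
    using assms by (intro map_pmf_of_set_bij_betw) auto
  also have "\<dots> = random_points n d S"
    using assms finite_A'_index unfolding random_points_def random_C_eq_pmf_of_set[OF assms]
    by (intro Pi_pmf_of_set[symmetric] finite_cartesian_product finite_PiE_dflt) auto
  finally show ?thesis by simp
qed

section \<open>From the count of zeros to the probability\<close>

theorem mainTheorem2:
  fixes d n :: nat
    and S :: "'a::field set"
    and f :: "(nat, 'a) cna_poly"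
  assumes "d \<ge> 1"
    and "infinite (UNIV :: 'a set) \<or> card (UNIV :: 'a set) > d"
    and "d = 1 \<or> CHAR('a) \<noteq> 2"
    and "finite S" and "card S > d"
    and "cna_vars f \<subseteq> {1..n}"
    and "f \<noteq> 0" and "cna_degree f \<le> d"
  shows "measure_pmf.prob (random_points n d S) {b. cna_eval d b f = 0} \<le> real d / real (card S)"
proof (cases "\<exists>t. Tree t \<in> Poly_Mapping.keys f")
  case True
  then obtain t where t: "Tree t \<in> Poly_Mapping.keys f" by blast
  have leaves: "leaves t \<le> d"
    using monom_degree_le_cna_degree[OF t] assms(8) by simp
  have "d = 1 \<or> (2::'a) \<noteq> 0"
  proof -
    have "CHAR('a) = 2" if "(2::'a) = 0"
      using that by (intro CHAR_eq_posI) (auto simp: less_2_cases_iff)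
    with assms(3) show ?thesis by blast
  qed
  then obtain b0 where b0: "fst (cna_eval d b0 f) (1, 1 + leaves t, 1) \<noteq> 0"
    using cna_eval_nonzero_coordinate[OF t leaves] by blast
  define F where "F x = fst (cna_eval d (points_of x) f) (1, 1 + leaves t, 1)" for x
  have "F (coords_of b0) \<noteq> 0"
    using b0 by (simp add: F_def)
  \<comment> \<open>The chosen coordinate lies in \<open>A'_index d\<close> because
    \<open>leaves t \<le> d\<close> and there are \<open>d + 1\<close> columns.\<close>
  moreover have "polynomial_fun (coords n d) d F"
    unfolding F_def using assms(1,6,8) leaves
    by (intro polynomial_fun_cna_eval) (auto simp: A'_index_def)
  moreover define P where "P = PiE_dflt (coords n d) 0 (\<lambda>_. S)"
  ultimately have count: "card {x \<in> P. F x = 0} * card S \<le> d * card S ^ card (coords n d)"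
    unfolding P_def by (intro schwartz_zippel[OF finite_coords assms(4)])
  have S: "S \<noteq> {}" "card S > 0"
    using assms(5) by auto
  have P: "finite P" "P \<noteq> {}"
    unfolding P_def using finite_coords S assms(4) by (auto intro!: finite_PiE_dflt)
  have card_P: "card P = card S ^ card (coords n d)"
    unfolding P_def using finite_coords assms(4) by (subst card_PiE_dflt) auto
  have "measure_pmf.prob (random_points n d S) {b. cna_eval d b f = 0} =
      measure_pmf.prob (pmf_of_set P) {x. cna_eval d (points_of x) f = 0}"
    unfolding random_points_eq_map_pmf[OF assms(4) S(1)] P_def by (simp add: vimage_def)
  \<comment> \<open>Wherever \<open>f\<close> evaluates to zero, so does its coordinate
    \<open>F\<close>.\<close>
  also have "\<dots> \<le> measure_pmf.prob (pmf_of_set P) {x. F x = 0}"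
    by (intro measure_pmf.finite_measure_mono) (auto simp: F_def zero_prod_def zero_fun_def)
  also have "\<dots> = real (card {x \<in> P. F x = 0}) / real (card P)"
    using P by (simp add: measure_pmf_of_set Int_def)
  also have "\<dots> \<le> real d / real (card S)"
  proof -
    have "real (card {x \<in> P. F x = 0}) * real (card S) \<le> real d * real (card P)"
      using of_nat_mono[OF count, where 'a = real] by (simp add: card_P)
    then show ?thesis
      using S P by (simp add: field_simps card_gt_0_iff)
  qed
  finally show ?thesis .
next
  case False
  \<comment> \<open>Without trees \<open>f\<close> is a non-zero multiple of \<open>One\<close>, and
    its scalar coordinate is non-zero at every point.\<close>
  then have "Poly_Mapping.keys f \<subseteq> {One}"
    by (metis cna_monom.exhaust insertI1 subsetI)
  moreover have "Poly_Mapping.keys f \<noteq> {}"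
    using assms(7) by simp
  ultimately have keys: "Poly_Mapping.keys f = {One}" by blast
  then have "One \<in> Poly_Mapping.keys f" by simp
  then have "Poly_Mapping.lookup f One \<noteq> 0" by (simp add: in_keys_iff)
  then have "snd (cna_eval d b f) \<noteq> 0" for b
    by (simp add: snd_cna_eval keys)
  then have "cna_eval d b f \<noteq> 0" for b
    by (metis snd_zero)
  then show ?thesis by simp
qed

end
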